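(* Let $\alpha>0$, $1\le p<\infty$, $f\in F_\alpha^p$, and let $n\ge 1$ be an integer. For $z\in\mathbb{C}$ put $$T_n(f,z)(w)=\sum_{k=0}^{n-1}\frac{f^{(k)}(z)}{k!}(w-z)^k,\qquad c_n(|z|)=\frac{(\alpha p/2)^{n/2}\,n!}{\Gamma\left(1+\frac{np}{2}\right)^{1/p}}\,e^{\frac{\alpha|z|^2}{2}}.$$ Then for every $z\in\mathbb{C}$ the following sharp estimate holds: $$|f^{(n)}(z)|\le c_n(|z|)\,\|f-T_n(f,z)\|_{p,\alpha}.$$ For each given $z\in\mathbb{C}$, equality at the point $z$ is attained for the function $f(w)=e^{\alpha(w-z)\bar z}(w-z)^n$. In particular, for $n=1$ one has the sharp estimate $$|f'(z)|\le\frac{(\alpha p/2)^{1/2}}{\Gamma\left(1+\frac p2\right)^{1/p}}\,e^{\frac{\alpha|z|^2}{2}}\,\|f(\cdot)-f(z)\|_{p,\alpha}.$$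
   Context: For $\alpha>0$ and $1\le p<\infty$, for measurable $f$ on $\mathbb{C}$, $$\|f\|_{p,\alpha}^p=\frac{p\alpha}{2\pi}\int_{\mathbb{C}}|f(z)|^p e^{-\frac{p\alpha|z|^2}{2}}\,dA(z),$$ where $dA$ is Lebesgue measure on $\mathbb{C}$. The Fock space $F_\alpha^p$ is the space of all entire functions $f$ with $\|f\|_{p,\alpha}<\infty$. $f^{(k)}$ denotes the $k$-th complex derivative and $\Gamma$ the Gamma function. *)

theory Defs
  imports "HOL-Complex_Analysis.Complex_Analysis"
begin

(* The norm takes values in [0, \<infinity>]: it is defined for every measurable f, and
   "norm < \<infinity>" is a genuine condition (no default value of a divergent integral).
   The case distinction is the 1/p-th power on ennreal. *)

definition fock_norm_pow :: "real \<Rightarrow> real \<Rightarrow> (complex \<Rightarrow> complex) \<Rightarrow> ennreal" where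
  "fock_norm_pow \<alpha> p f =
     ennreal (p * \<alpha> / (2 * pi)) *
     (\<integral>\<^sup>+ z. ennreal (cmod (f z) powr p * exp (- (p * \<alpha> * (cmod z)\<^sup>2 / 2))) \<partial>lebesgue)"

definition fock_norm :: "real \<Rightarrow> real \<Rightarrow> (complex \<Rightarrow> complex) \<Rightarrow> ennreal" where
  "fock_norm \<alpha> p f =
     (if fock_norm_pow \<alpha> p f = \<infinity> then \<infinity>
      else ennreal (enn2real (fock_norm_pow \<alpha> p f) powr (1 / p)))"

definition fock_space :: "real \<Rightarrow> real \<Rightarrow> (complex \<Rightarrow> complex) set" where
  "fock_space \<alpha> p = {f. f holomorphic_on UNIV \<and> fock_norm \<alpha> p f < \<infinity>}"

definition taylor_poly :: "nat \<Rightarrow> (complex \<Rightarrow> complex) \<Rightarrow> complex \<Rightarrow> complex \<Rightarrow> complex" where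
  "taylor_poly n f z w = (\<Sum>k<n. (deriv ^^ k) f z / fact k * (w - z) ^ k)"

definition fock_const :: "real \<Rightarrow> real \<Rightarrow> nat \<Rightarrow> real \<Rightarrow> real" where
  "fock_const \<alpha> p n r =
     (\<alpha> * p / 2) powr (real n / 2) * fact n / Gamma (1 + real n * p / 2) powr (1 / p)
       * exp (\<alpha> * r\<^sup>2 / 2)"

end

theory Submission
  imports Defs
begin

(* The substitution w = z + u together with the twist by exp (- \<alpha> u cnj z - \<alpha> |z|^2 / 2)
   preserves the Fock norm, so the expansion point may be moved to 0. There the Taylor remainder
   is u^n H u with H entire and |H 0| = |deriv^n f z| / n! exp (- \<alpha> |z|^2 / 2). Since the
   remaining weight |u|^(n p) exp (- p \<alpha> |u|^2 / 2) is radial, averaging over rotations and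
   using the sub-mean value property of |H|^p bounds the norm below by |H 0| times the norm of u^n,
   with equality when H is constant. *)

section \<open>Lebesgue measure: translations, orthogonal maps and radial integrals\<close>

lemma nn_integral_lborel_plus:
  fixes f :: "'a::euclidean_space \<Rightarrow> ennreal"
  assumes [measurable]: "f \<in> borel_measurable borel"
  shows "(\<integral>\<^sup>+x. f (c + x) \<partial>lborel) = (\<integral>\<^sup>+x. f x \<partial>lborel)"
proof -
  have "(\<integral>\<^sup>+x. f x \<partial>lborel) = (\<integral>\<^sup>+x. f x \<partial>distr lborel borel ((+) c))"
    by (simp add: lborel_distr_plus)
  also have "\<dots> = (\<integral>\<^sup>+x. f (c + x) \<partial>lborel)"
    by (subst nn_integral_distr) auto
  finally show ?thesis ..
qed

(* Uniqueness of an invariant measure in miniature: Fubini applied to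
   1_B(y) f(T x + y), with B the unit ball, and translation invariance in either variable. *)
lemma nn_integral_lborel_orthogonal_transformation:
  fixes T :: "'a::euclidean_space \<Rightarrow> 'a" and f :: "'a \<Rightarrow> ennreal"
  assumes T: "orthogonal_transformation T"
    and [measurable]: "f \<in> borel_measurable borel"
  shows "(\<integral>\<^sup>+x. f (T x) \<partial>lborel) = (\<integral>\<^sup>+x. f x \<partial>lborel)"
proof -
  have lin: "linear T"
    using T by (simp add: orthogonal_transformation_def)
  have [measurable]: "T \<in> borel_measurable borel"
    using lin by (intro borel_measurable_continuous_onI linear_continuous_on)
      (simp add: linear_conv_bounded_linear)
  have surj: "surj T"
    by (rule linear_injective_imp_surjective[OF lin orthogonal_transformation_inj[OF T]]) (rule refl)
  define B where "B = ball (0::'a) 1"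
  have [measurable]: "B \<in> sets borel"
    by (simp add: B_def)
  \<comment> \<open>\<open>V\<close> is positive and finite, so it can be cancelled once Fubini has
    produced it as a factor on both sides.\<close>
  define V where "V = emeasure lborel B"
  have V: "V \<noteq> 0" "V \<noteq> \<infinity>"
    using emeasure_ball[of 1 "0::'a"] unit_ball_vol_pos[of "real DIM('a)"]
    by (simp_all add: V_def B_def del: unit_ball_vol_pos)
  \<comment> \<open>\<open>T\<close> is onto, so adding \<open>y\<close> after \<open>T\<close>
    amounts to adding a preimage of \<open>y\<close> before \<open>T\<close>, which the integral
    does not see.\<close>
  have shift: "(\<integral>\<^sup>+x. f (T x) \<partial>lborel) = (\<integral>\<^sup>+x. f (T x + y) \<partial>lborel)" for y
  proof -
    obtain y' where y': "y = T y'"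
      using surj by (metis surjD)
    show ?thesis
      using nn_integral_lborel_plus[of "\<lambda>x. f (T x)" y']
      by (simp add: y' linear_add[OF lin] add.commute)
  qed
  \<comment> \<open>Since \<open>T\<close> is an isometry, the points \<open>x\<close> with
    \<open>y - T x\<close> in \<open>B\<close> form the unit ball about the preimage of
    \<open>y\<close>, whose volume does not depend on \<open>y\<close>.\<close>
  have slice: "(\<integral>\<^sup>+x. indicator B (y - T x) \<partial>lborel) = V" for y
  proof -
    obtain y' where y': "y = T y'"
      using surj by (metis surjD)
    have "(y - T x \<in> B) = (x \<in> ball y' 1)" for x
      using orthogonal_transformation_norm[OF T, of "y' - x"]
      by (simp add: B_def y' linear_diff[OF lin] dist_norm norm_minus_commute[of "T x"])
    then have "(\<lambda>x. indicator B (y - T x) :: ennreal) = indicator (ball y' 1)"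
      by (auto simp: indicator_def)
    then show ?thesis
      using emeasure_ball[of 1 y'] emeasure_ball[of 1 "0::'a"] by (simp add: V_def B_def)
  qed
  have "V * (\<integral>\<^sup>+x. f (T x) \<partial>lborel) = (\<integral>\<^sup>+y. indicator B y * (\<integral>\<^sup>+x. f (T x) \<partial>lborel) \<partial>lborel)"
    by (simp add: nn_integral_multc V_def)
  also have "\<dots> = (\<integral>\<^sup>+y. (\<integral>\<^sup>+x. indicator B y * f (T x + y) \<partial>lborel) \<partial>lborel)"
    by (subst nn_integral_cmult) (auto intro!: nn_integral_cong simp flip: shift)
  also have "\<dots> = (\<integral>\<^sup>+x. (\<integral>\<^sup>+y. indicator B y * f (T x + y) \<partial>lborel) \<partial>lborel)"
    by (rule lborel_pair.Fubini') measurable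
  also have "\<dots> = (\<integral>\<^sup>+x. (\<integral>\<^sup>+y. indicator B (y - T x) * f y \<partial>lborel) \<partial>lborel)"
  proof (rule nn_integral_cong)
    fix x
    show "(\<integral>\<^sup>+y. indicator B y * f (T x + y) \<partial>lborel) = (\<integral>\<^sup>+y. indicator B (y - T x) * f y \<partial>lborel)"
      using nn_integral_lborel_plus[of "\<lambda>y. indicator B (y - T x) * f y" "T x"] by simp
  qed
  also have "\<dots> = (\<integral>\<^sup>+y. (\<integral>\<^sup>+x. indicator B (y - T x) * f y \<partial>lborel) \<partial>lborel)"
    by (rule lborel_pair.Fubini') measurable
  also have "\<dots> = (\<integral>\<^sup>+y. V * f y \<partial>lborel)"
    by (intro nn_integral_cong) (simp add: nn_integral_multc slice)
  also have "\<dots> = V * (\<integral>\<^sup>+x. f x \<partial>lborel)"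
    by (simp add: nn_integral_cmult)
  finally show ?thesis
    using V by (simp add: ennreal_mult_cancel_left)
qed

(* The sign makes the half-lines {x<..} pull back to discs, which have finite measure. *)
lemma distr_lborel_neg_norm_sq:
  "distr lborel borel (\<lambda>u::complex. - (norm u)\<^sup>2) = density lborel (\<lambda>t. ennreal pi * indicator {..0} t)"
proof (rule measure_eqI_lessThan)
  fix x :: real
  have disc: "emeasure (distr lborel borel (\<lambda>u::complex. - (norm u)\<^sup>2)) {x<..} = ennreal (pi * max 0 (- x))"
  proof (cases "x < 0")
    case True
    have "norm u < sqrt (- x) \<longleftrightarrow> x < - (norm u)\<^sup>2" for u :: complex
      by (metis abs_norm_cancel less_minus_iff real_sqrt_abs real_sqrt_less_iff)
    then have "(\<lambda>u::complex. - (norm u)\<^sup>2) -` {x<..} = ball 0 (sqrt (- x))"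
      by (auto simp: dist_norm)
    with True show ?thesis
      by (simp add: emeasure_distr emeasure_ball unit_ball_vol_2)
  next
    case False
    then have "\<not> x < - (norm u)\<^sup>2" for u :: complex
      using zero_le_power2[of "norm u"] by linarith
    then have "(\<lambda>u::complex. - (norm u)\<^sup>2) -` {x<..} = {}"
      by auto
    with False show ?thesis
      by (simp add: emeasure_distr)
  qed
  show "emeasure (distr lborel borel (\<lambda>u::complex. - (norm u)\<^sup>2)) {x<..} < \<infinity>"
    by (simp add: disc)
  have "emeasure (density lborel (\<lambda>t. ennreal pi * indicator {..0} t)) {x<..}
      = (\<integral>\<^sup>+t. ennreal pi * indicator {x<..0} t \<partial>lborel)"
    by (subst emeasure_density) (auto intro!: nn_integral_cong split: split_indicator)
  also have "\<dots> = ennreal (pi * max 0 (- x))"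
    by (cases "x \<le> 0") (auto simp: nn_integral_cmult_indicator simp flip: ennreal_mult)
  finally show "emeasure (distr lborel borel (\<lambda>u::complex. - (norm u)\<^sup>2)) {x<..} =
      emeasure (density lborel (\<lambda>t. ennreal pi * indicator {..0} t)) {x<..}"
    using disc by simp
qed auto

text \<open>Polar coordinates with the angle integrated out: in the variable
  \<open>t = |u|^2\<close> the area element is \<open>pi dt\<close>. The law of
  \<open>- |u|^2\<close> is already known, and the reflection of \<open>t\<close> restores the
  sign.\<close>

lemma nn_integral_radial:
  fixes \<phi> :: "real \<Rightarrow> ennreal"
  assumes [measurable]: "\<phi> \<in> borel_measurable borel"
  shows "(\<integral>\<^sup>+(u::complex). \<phi> ((norm u)\<^sup>2) \<partial>lborel) = ennreal pi * (\<integral>\<^sup>+t. indicator {0..} t * \<phi> t \<partial>lborel)"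
proof -
  have "(\<integral>\<^sup>+(u::complex). \<phi> ((norm u)\<^sup>2) \<partial>lborel)
      = (\<integral>\<^sup>+t. \<phi> (- t) \<partial>distr lborel borel (\<lambda>u::complex. - (norm u)\<^sup>2))"
    by (subst nn_integral_distr) auto
  also have "\<dots> = (\<integral>\<^sup>+t. ennreal pi * (indicator {..0} t * \<phi> (- t)) \<partial>lborel)"
    by (simp add: distr_lborel_neg_norm_sq nn_integral_density mult.assoc)
  also have "\<dots> = ennreal pi * (\<integral>\<^sup>+t. indicator {..0} t * \<phi> (- t) \<partial>lborel)"
    by (simp add: nn_integral_cmult)
  also have "(\<integral>\<^sup>+t. indicator {..0} t * \<phi> (- t) \<partial>lborel) = (\<integral>\<^sup>+t. indicator {0..} t * \<phi> t \<partial>lborel)"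
    by (subst nn_integral_real_affine[where c = "-1" and t = 0])
      (auto intro!: nn_integral_cong split: split_indicator)
  finally show ?thesis .
qed

section \<open>Mean values of entire functions over circles\<close>

text \<open>Cauchy's integral formula on the unit circle for
  \<open>\<zeta> \<mapsto> h (\<zeta> * u)\<close>. Moving \<open>u\<close> into the function keeps
  the contour fixed, so \<open>u = 0\<close> is no special case.\<close>

lemma entire_mean_value:
  assumes "h holomorphic_on UNIV"
  shows "((\<lambda>t. h (cis t * u)) has_integral (of_real (2 * pi) * h 0)) {0..2 * pi}"
proof -
  define g where "g = (\<lambda>\<zeta>. h (\<zeta> * u))"
  have "g holomorphic_on UNIV"
    unfolding g_def by (rule holomorphic_on_compose_gen[OF _ assms, unfolded o_def])
      (auto intro!: holomorphic_intros)
  then have "((\<lambda>\<zeta>. g \<zeta> / (\<zeta> - 0)) has_contour_integral (2 * of_real pi * \<i> * g 0)) (circlepath 0 1)"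
    by (intro Cauchy_integral_circlepath_simple) (auto intro: holomorphic_on_subset)
  then have "((\<lambda>t. g (cis t) * \<i>) has_integral (2 * of_real pi * \<i> * g 0)) {0..2 * pi}"
    by (simp add: circlepath_def has_contour_integral_part_circlepath_iff)
  \<comment> \<open>On the unit circle \<open>d\<zeta> / \<zeta>\<close> is \<open>i dt\<close>;
    multiplying by \<open>- \<i>\<close> removes the factor.\<close>
  then have "((\<lambda>t. - \<i> * (g (cis t) * \<i>)) has_integral (- \<i> * (2 * of_real pi * \<i> * g 0))) {0..2 * pi}"
    by (rule has_integral_mult_right)
  then show ?thesis
    by (simp add: g_def algebra_simps)
qed

text \<open>A convex function lies above its tangent at \<open>a\<close>. Integrated in
  \<open>x\<close>, this yields Jensen's inequality for the power \<open>p\<close>.\<close>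

lemma powr_ge_tangent:
  fixes a x p :: real
  assumes "1 \<le> p" "0 \<le> a" "0 \<le> x"
  shows "a powr p + p * a powr (p - 1) * (x - a) \<le> x powr p"
proof -
  \<comment> \<open>Convexity with a derivative is available on the open half-line only, so the
    boundary is separate. At \<open>a = 0\<close> the left side is 0, also for \<open>p = 1\<close>
    because \<open>0 powr 0 = 0\<close>; at \<open>x = 0\<close> it is
    \<open>(1 - p) * a powr p\<close>.\<close>
  consider "a = 0" | "a > 0" "x = 0" | "a > 0" "x > 0"
    using assms by linarith
  then show ?thesis
  proof cases
    case 2
    have "a powr (p - 1) * a = a powr p"
      using 2 by (simp add: powr_mult_base mult.commute)
    then show ?thesis
      using 2 assms mult_right_mono[of 1 p "a powr p"] by (simp add: algebra_simps)
  next
    case 3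
    have "x powr p - a powr p \<ge> (p * a powr (p - 1)) * (x - a)"
    proof (rule convex_on_imp_above_tangent[OF powr_convex[OF assms(1)]])
      show "((\<lambda>x. x powr p) has_field_derivative p * a powr (p - 1)) (at a within {0<..})"
        using 3 by (auto intro!: derivative_eq_intros)
    qed (use 3 in \<open>auto simp: interior_open\<close>)
    then show ?thesis by simp
  qed auto
qed

text \<open>The sub-mean value property of \<open>|h|^p\<close>: the mean value formula bounds
  \<open>|h 0|\<close> by the mean of \<open>|h|\<close> over the circle, and Jensen's inequality
  passes to the power \<open>p\<close>.\<close>

lemma entire_mean_powr_ge:
  assumes hol: "h holomorphic_on UNIV" and p: "1 \<le> p"
  shows "ennreal (2 * pi * cmod (h 0) powr p)
    \<le> (\<integral>\<^sup>+t. ennreal (cmod (h (cis t * u)) powr p) * indicator {0..2 * pi} t \<partial>lborel)"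
proof -
  define a where "a = cmod (h 0)"
  define k where "k = (\<lambda>t. cmod (h (cis t * u)))"
  have cont: "continuous_on {0..2 * pi} (\<lambda>t. h (cis t * u))"
    by (rule continuous_on_compose2[OF holomorphic_on_imp_continuous_on[OF hol]])
      (auto intro!: continuous_intros)
  have k: "continuous_on {0..2 * pi} k"
    unfolding k_def by (intro continuous_intros cont)
  have kp: "(\<lambda>t. k t powr p) integrable_on {0..2 * pi}"
    using p by (intro integrable_continuous_real continuous_on_powr' k continuous_intros)
      (auto simp: k_def)
  have "cmod (integral {0..2 * pi} (\<lambda>t. h (cis t * u))) \<le> integral {0..2 * pi} k"
    by (rule integral_norm_bound_integral)
      (auto simp: k_def intro!: integrable_continuous_real continuous_intros cont)
  then have mean: "2 * pi * a \<le> integral {0..2 * pi} k"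
    using integral_unique[OF entire_mean_value[OF hol, of u]] by (simp add: a_def norm_mult)
  \<comment> \<open>The added term is the nonnegative slope of the tangent at \<open>a\<close> times
    the excess of the integral of \<open>k\<close> over \<open>2 * pi * a\<close>. The sum is the
    integral of the tangent line along \<open>k\<close>, hence at most that of
    \<open>k t powr p\<close>.\<close>
  have "2 * pi * a powr p \<le> 2 * pi * a powr p + p * a powr (p - 1) * (integral {0..2 * pi} k - 2 * pi * a)"
    using mean p by simp
  also have "\<dots> = integral {0..2 * pi} (\<lambda>t. a powr p + p * a powr (p - 1) * (k t - a))"
    by (subst integral_add integral_mult_right integral_diff;
        (intro integrable_continuous_real continuous_intros k)?)+ (simp add: algebra_simps)
  also have "\<dots> \<le> integral {0..2 * pi} (\<lambda>t. k t powr p)"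
    using p by (intro integral_le kp powr_ge_tangent integrable_continuous_real continuous_intros k)
      (auto simp: k_def a_def)
  finally have "ennreal (2 * pi * a powr p) \<le> ennreal (integral {0..2 * pi} (\<lambda>t. k t powr p))"
    by (rule ennreal_leI)
  also have "\<dots> = (\<integral>\<^sup>+t. ennreal (k t powr p) * indicator {0..2 * pi} t \<partial>lborel)"
    by (rule nn_integral_has_integral_lebesgue'[symmetric])
      (auto intro: integrable_integral kp)
  finally show ?thesis
    by (simp add: a_def k_def)
qed

text \<open>Rotating \<open>u\<close> by \<open>cis t\<close> changes neither the measure nor the
  radial weight, so the right side equals its own average over \<open>t\<close>. After exchanging
  the integrals, the circle inequality applies for each fixed \<open>u\<close>.\<close>

lemma entire_radial_integral_ge:
  fixes \<phi> :: "real \<Rightarrow> ennreal"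
  assumes hol: "h holomorphic_on UNIV" and p: "1 \<le> p"
    and [measurable]: "\<phi> \<in> borel_measurable borel"
  shows "ennreal (cmod (h 0) powr p) * (\<integral>\<^sup>+(u::complex). \<phi> (cmod u) \<partial>lborel)
    \<le> (\<integral>\<^sup>+u. ennreal (cmod (h u) powr p) * \<phi> (cmod u) \<partial>lborel)" (is "_ \<le> ?I")
proof -
  have [measurable]: "h \<in> borel_measurable borel"
    by (intro borel_measurable_continuous_onI holomorphic_on_imp_continuous_on hol)
  have [measurable]: "cis \<in> borel_measurable borel"
    by (intro borel_measurable_continuous_onI continuous_intros)
  have orth: "orthogonal_transformation ((*) (cis t))" for t
    by (auto simp: orthogonal_transformation norm_mult intro!: linearI simp: algebra_simps)
  have rot: "(\<integral>\<^sup>+u. ennreal (cmod (h (cis t * u)) powr p) * \<phi> (cmod u) \<partial>lborel) = ?I" for t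
    using nn_integral_lborel_orthogonal_transformation
      [OF orth, of "\<lambda>u. ennreal (cmod (h u) powr p) * \<phi> (cmod u)" t]
    by (simp add: norm_mult)
  have "ennreal (2 * pi) * (ennreal (cmod (h 0) powr p) * (\<integral>\<^sup>+(u::complex). \<phi> (cmod u) \<partial>lborel))
      = (\<integral>\<^sup>+(u::complex). ennreal (2 * pi * cmod (h 0) powr p) * \<phi> (cmod u) \<partial>lborel)"
    by (simp add: nn_integral_cmult ennreal_mult mult.assoc)
  also have "\<dots> \<le> (\<integral>\<^sup>+u. (\<integral>\<^sup>+t. ennreal (cmod (h (cis t * u)) powr p) * indicator {0..2 * pi} t \<partial>lborel)
      * \<phi> (cmod u) \<partial>lborel)"
    by (intro nn_integral_mono mult_right_mono entire_mean_powr_ge hol p) auto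
  also have "\<dots> = (\<integral>\<^sup>+u. (\<integral>\<^sup>+t. ennreal (cmod (h (cis t * u)) powr p) * indicator {0..2 * pi} t
      * \<phi> (cmod u) \<partial>lborel) \<partial>lborel)"
    by (simp add: nn_integral_multc)
  also have "\<dots> = (\<integral>\<^sup>+t. (\<integral>\<^sup>+u. ennreal (cmod (h (cis t * u)) powr p) * indicator {0..2 * pi} t
      * \<phi> (cmod u) \<partial>lborel) \<partial>lborel)"
    by (rule lborel_pair.Fubini') measurable
  also have "\<dots> = (\<integral>\<^sup>+t. indicator {0..2 * pi} t * ?I \<partial>lborel)"
  proof (rule nn_integral_cong)
    fix t
    show "(\<integral>\<^sup>+u. ennreal (cmod (h (cis t * u)) powr p) * indicator {0..2 * pi} t * \<phi> (cmod u) \<partial>lborel)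
      = indicator {0..2 * pi} t * ?I"
      by (cases "t \<in> {0..2 * pi}") (simp_all add: rot)
  qed
  also have "\<dots> = ennreal (2 * pi) * ?I"
    by (simp add: nn_integral_multc)
  finally show ?thesis
    by (subst (asm) ennreal_mult_le_mult_iff) (auto simp: top_unique)
qed

section \<open>Taylor remainders and derivatives at a zero of order n\<close>

text \<open>The quotient \<open>h\<close> is the Taylor series of \<open>f\<close> with its first
  \<open>n\<close> terms dropped and its exponents lowered by \<open>n\<close>; it converges on the
  whole plane because the series of \<open>f\<close> does.\<close>

lemma entire_taylor_remainder:
  assumes hol: "f holomorphic_on UNIV"
  obtains h where "h holomorphic_on UNIV"
    and "\<And>w. f w - taylor_poly n f z w = (w - z) ^ n * h w"
    and "h z = (deriv ^^ n) f z / fact n"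
proof
  define a where "a = (\<lambda>k. (deriv ^^ k) f z / fact k)"
  define h where "h = (\<lambda>w. \<Sum>k. a (k + n) * (w - z) ^ k)"
  have f_sums: "(\<lambda>k. a k * (w - z) ^ k) sums f w" for w
    unfolding a_def
    by (rule holomorphic_power_series[of f z "dist z w + 1"])
      (auto intro: holomorphic_on_subset[OF hol])
  have h_sums: "(\<lambda>k. a (k + n) * (w - z) ^ k) sums h w" for w
  \<comment> \<open>Away from \<open>z\<close> the factor \<open>(w - z) ^ n\<close> can be divided
    out of the tail of a convergent series; at \<open>z\<close> only the constant term is
    left.\<close>
  proof (cases "w = z")
    case False
    have "summable (\<lambda>k. a (k + n) * (w - z) ^ (k + n))"
      using f_sums[of w] by (subst summable_iff_shift) (rule sums_summable)
    then have "summable (\<lambda>k. (w - z) ^ n * (a (k + n) * (w - z) ^ k))"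
      by (simp add: power_add mult_ac)
    with False show ?thesis
      by (simp add: h_def summable_sums)
  next
    case True
    then show ?thesis
      using powser_sums_zero[of "\<lambda>k. a (k + n)"] by (simp add: h_def sums_iff)
  qed
  have "h holomorphic_on ball z r" for r
    by (rule power_series_holomorphic) (rule h_sums)
  then have "h holomorphic_on (\<Union>r. ball z r)"
    by (intro holomorphic_on_UN_open) auto
  also have "(\<Union>r. ball z r) = UNIV"
    by (auto simp: gt_ex)
  finally show "h holomorphic_on UNIV" .
  show "h z = (deriv ^^ n) f z / fact n"
    using h_sums[of z] powser_sums_zero[of "\<lambda>k. a (k + n)"] by (auto simp: a_def dest: sums_unique2)
  show "f w - taylor_poly n f z w = (w - z) ^ n * h w" for w
  proof -
    have "(\<lambda>k. (w - z) ^ n * (a (k + n) * (w - z) ^ k)) sums ((w - z) ^ n * h w)"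
      by (intro sums_mult h_sums)
    then have "(\<lambda>k. a (k + n) * (w - z) ^ (k + n)) sums ((w - z) ^ n * h w)"
      by (simp add: power_add mult_ac)
    moreover have "(\<lambda>k. a (k + n) * (w - z) ^ (k + n)) sums (f w - taylor_poly n f z w)"
      using sums_split_initial_segment[OF f_sums[of w], of n] by (simp add: taylor_poly_def a_def)
    ultimately show ?thesis
      by (rule sums_unique2[symmetric])
  qed
qed

text \<open>In the Leibniz rule, derivatives of \<open>(w - z) ^ n\<close> of order below
  \<open>n\<close> vanish at \<open>z\<close>, so the only term that can survive has all
  \<open>k = n\<close> derivatives on the power.\<close>

lemma higher_deriv_power_mult:
  assumes "g holomorphic_on UNIV" "k \<le> n"
  shows "(deriv ^^ k) (\<lambda>w. g w * (w - z) ^ n) z = (if k = n then fact n * g z else 0)"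
proof -
  have pow: "(deriv ^^ j) (\<lambda>w. (w - z) ^ n) z = (if j = n then fact n else 0)" if "j \<le> n" for j
    using that by (simp add: higher_deriv_power pochhammer_fact)
  have "(deriv ^^ k) (\<lambda>w. g w * (w - z) ^ n) z =
      (\<Sum>i = 0..k. of_nat (k choose i) * (deriv ^^ i) g z * (deriv ^^ (k - i)) (\<lambda>w. (w - z) ^ n) z)"
    by (rule higher_deriv_mult[of _ UNIV]) (use assms in \<open>auto intro!: holomorphic_intros\<close>)
  also have "\<dots> = (\<Sum>i = 0..k. if i = 0 then (if k = n then fact n * g z else 0) else 0)"
    using assms(2) by (intro sum.cong) (auto simp: pow)
  finally show ?thesis by simp
qed

section \<open>The Fock norm: translation, scaling and monomials\<close>

text \<open>By \<open>|z + u|^2 = |z|^2 + 2 Re (u * cnj z) + |u|^2\<close>, the translated Gaussian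
  is the original one times the \<open>p\<close>-th power of the modulus of the exponential
  factor.\<close>

lemma fock_norm_pow_translate:
  assumes [measurable]: "g \<in> borel_measurable borel"
  shows "fock_norm_pow \<alpha> p g =
    fock_norm_pow \<alpha> p (\<lambda>u. g (z + u) * exp (- (\<alpha> * u * cnj z) - \<alpha> * (cmod z)\<^sup>2 / 2))"
proof -
  have "cmod (g (z + u)) powr p * exp (- (p * \<alpha> * (cmod (z + u))\<^sup>2 / 2))
    = cmod (g (z + u) * exp (- (\<alpha> * u * cnj z) - \<alpha> * (cmod z)\<^sup>2 / 2)) powr p
        * exp (- (p * \<alpha> * (cmod u)\<^sup>2 / 2))" for u :: complex
  proof -
    have "- (p * \<alpha> * (cmod (z + u))\<^sup>2 / 2)
      = p * Re (- (\<alpha> * u * cnj z) - \<alpha> * (cmod z)\<^sup>2 / 2) + - (p * \<alpha> * (cmod u)\<^sup>2 / 2)"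
      unfolding cmod_power2 by (simp add: power2_eq_square field_simps)
    then show ?thesis
      unfolding norm_mult norm_exp_eq_Re
      by (simp only: powr_mult exp_add norm_ge_zero exp_ge_zero exp_powr_real mult.commute[of _ p] mult.assoc)
  qed
  moreover have "(\<integral>\<^sup>+w. ennreal (cmod (g w) powr p * exp (- (p * \<alpha> * (cmod w)\<^sup>2 / 2))) \<partial>lborel)
    = (\<integral>\<^sup>+u. ennreal (cmod (g (z + u)) powr p * exp (- (p * \<alpha> * (cmod (z + u))\<^sup>2 / 2))) \<partial>lborel)"
    by (rule nn_integral_lborel_plus[symmetric]) measurable
  ultimately show ?thesis
    by (simp add: fock_norm_pow_def nn_integral_completion)
qed

lemma fock_norm_pow_cmult:
  assumes [measurable]: "g \<in> borel_measurable borel"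
  shows "fock_norm_pow \<alpha> p (\<lambda>u. c * g u) = ennreal (cmod c powr p) * fock_norm_pow \<alpha> p g"
proof -
  have "ennreal (cmod (c * g u) powr p * exp (- (p * \<alpha> * (cmod u)\<^sup>2 / 2)))
      = ennreal (cmod c powr p) * ennreal (cmod (g u) powr p * exp (- (p * \<alpha> * (cmod u)\<^sup>2 / 2)))" for u
    by (simp add: norm_mult powr_mult mult_ac flip: ennreal_mult)
  then show ?thesis
    by (simp only: fock_norm_pow_def nn_integral_completion)
      (simp add: nn_integral_cmult mult.left_commute)
qed

text \<open>For \<open>n \<ge> 1\<close> this is the closed form of the \<open>p\<close>-th power of
  the Fock norm of \<open>u ^ n\<close>.\<close>

definition fock_moment :: "real \<Rightarrow> real \<Rightarrow> nat \<Rightarrow> real" where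
  "fock_moment \<alpha> p n = (2 / (p * \<alpha>)) powr (real n * p / 2) * Gamma (1 + real n * p / 2)"

lemma fock_moment_pos:
  assumes "\<alpha> > 0" "p > 0"
  shows "fock_moment \<alpha> p n > 0"
  using assms by (simp add: fock_moment_def Gamma_real_pos add_pos_nonneg)

text \<open>Radial integration in \<open>t = |u|^2\<close>, followed by rescaling \<open>t\<close>
  so that the exponential weight becomes \<open>exp (- t)\<close>, leaves Euler's integral for the
  Gamma function.\<close>

lemma fock_norm_pow_monomial:
  assumes \<alpha>: "\<alpha> > 0" and p: "p > 0" and n: "n \<ge> 1"
  shows "fock_norm_pow \<alpha> p (\<lambda>u. u ^ n) = ennreal (fock_moment \<alpha> p n)"
proof -
  \<comment> \<open>The weight \<open>exp (- (p * \<alpha> * |u|^2 / 2))\<close> is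
    \<open>exp (- (t / c))\<close>, and \<open>|u|^(n p)\<close> is \<open>t powr s\<close>.\<close>
  define c where "c = 2 / (p * \<alpha>)"
  define s where "s = real n * p / 2"
  have c: "c > 0" and s: "s > 0"
    using assms by (simp_all add: c_def s_def)
  define \<phi> where "\<phi> = (\<lambda>t. ennreal (t powr s * exp (- (t / c))))"
  have [measurable]: "\<phi> \<in> borel_measurable borel"
    unfolding \<phi>_def by measurable
  have radial: "ennreal (cmod (u ^ n) powr p * exp (- (p * \<alpha> * (cmod u)\<^sup>2 / 2))) = \<phi> ((cmod u)\<^sup>2)" for u
  proof -
    have "cmod (u ^ n) powr p = ((cmod u)\<^sup>2) powr s"
    \<comment> \<open>At \<open>u = 0\<close> both sides are 0 because \<open>n \<ge> 1\<close>; for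
      \<open>n = 0\<close> the left side would be 1, but \<open>0 powr 0 = 0\<close>.\<close>
    proof (cases "u = 0")
      case False
      then have "cmod u ^ n = cmod u powr real n" "(cmod u)\<^sup>2 = cmod u powr 2"
        by (simp_all add: powr_realpow)
      then show ?thesis
        by (simp only: norm_power powr_powr s_def) simp
    qed (use n in \<open>simp add: power_0_left\<close>)
    then show ?thesis
      by (simp add: \<phi>_def c_def mult_ac)
  qed
  have "(\<integral>\<^sup>+t. indicator {0..} t * \<phi> t \<partial>lborel)
      = ennreal c * (\<integral>\<^sup>+t. indicator {0..} (c * t) * \<phi> (c * t) \<partial>lborel)"
    using c by (subst nn_integral_real_affine[where c = c and t = 0]) auto
  \<comment> \<open>The exponent is written \<open>1 + s - 1\<close> to match the integrand of the
    Gamma function at \<open>1 + s\<close>.\<close>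
  also have "(\<integral>\<^sup>+t. indicator {0..} (c * t) * \<phi> (c * t) \<partial>lborel)
      = (\<integral>\<^sup>+t. ennreal (c powr s) * ennreal (indicator {0..} t * t powr (1 + s - 1) / exp t) \<partial>lborel)"
  proof (rule nn_integral_cong)
    fix t
    show "indicator {0..} (c * t) * \<phi> (c * t)
        = ennreal (c powr s) * ennreal (indicator {0..} t * t powr (1 + s - 1) / exp t)"
    proof (cases "t \<ge> 0")
      case True
      have "(c * t) powr s * exp (- (c * t / c)) = c powr s * (t powr s / exp t)"
        using c by (simp add: powr_mult exp_minus divide_inverse)
      with True c show ?thesis
        by (simp add: \<phi>_def flip: ennreal_mult)
    qed (use c in \<open>simp add: zero_le_mult_iff\<close>)
  qed
  also have "\<dots> = ennreal (c powr s) * ennreal (Gamma (1 + s))"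
    using s by (subst nn_integral_cmult) (auto simp: Gamma_conv_nn_integral_real)
  finally have int: "(\<integral>\<^sup>+t. indicator {0..} t * \<phi> t \<partial>lborel)
      = ennreal (c * (c powr s * Gamma (1 + s)))"
    using c s by (simp add: ennreal_mult Gamma_real_pos less_imp_le)
  have "fock_norm_pow \<alpha> p (\<lambda>u. u ^ n) = ennreal (p * \<alpha> / (2 * pi)) * (\<integral>\<^sup>+(u::complex). \<phi> ((cmod u)\<^sup>2) \<partial>lborel)"
    by (simp add: fock_norm_pow_def nn_integral_completion radial)
  also have "\<dots> = ennreal (p * \<alpha> / (2 * pi)) * (ennreal pi * ennreal (c * (c powr s * Gamma (1 + s))))"
    by (simp add: nn_integral_radial int)
  also have "\<dots> = ennreal (p * \<alpha> / (2 * pi) * (pi * (c * (c powr s * Gamma (1 + s)))))"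
    using assms c s by (simp only: ennreal_mult[symmetric] Gamma_real_pos less_imp_le
        mult_nonneg_nonneg divide_nonneg_nonneg powr_ge_zero pi_ge_zero zero_le_numeral add_pos_pos zero_less_one)
  \<comment> \<open>The Jacobian \<open>c\<close> and the area factor \<open>pi\<close> cancel the
    normalisation of the norm exactly.\<close>
  also have "p * \<alpha> / (2 * pi) * (pi * (c * (c powr s * Gamma (1 + s)))) = fock_moment \<alpha> p n"
    using assms by (simp add: fock_moment_def c_def s_def)
  finally show ?thesis .
qed

text \<open>The denominator is the Fock norm of \<open>u ^ n\<close> when \<open>n \<ge> 1\<close>.
  Both the estimate and the extremal function produce the constant in this form.\<close>

lemma fock_const_eq:
  assumes "\<alpha> > 0" "p > 0"
  shows "fock_const \<alpha> p n r = fact n * exp (\<alpha> * r\<^sup>2 / 2) / fock_moment \<alpha> p n powr (1 / p)"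
proof -
  have "((2 / (p * \<alpha>)) powr (real n * p / 2)) powr (1 / p) = (2 / (p * \<alpha>)) powr (real n / 2)"
    using assms by (simp add: powr_powr)
  also have "\<dots> = inverse ((\<alpha> * p / 2) powr (real n / 2))"
  proof -
    have "2 / (p * \<alpha>) = inverse (\<alpha> * p / 2)"
      by (simp add: mult.commute)
    then show ?thesis
      by (simp only: inverse_powr)
  qed
  finally have "fock_moment \<alpha> p n powr (1 / p)
      = inverse ((\<alpha> * p / 2) powr (real n / 2)) * Gamma (1 + real n * p / 2) powr (1 / p)"
    by (simp only: fock_moment_def powr_mult)
  then show ?thesis
    by (simp only: fock_const_def divide_inverse inverse_mult_distrib inverse_inverse_eq mult_ac)
qed

lemma fock_norm_ge:
  assumes "ennreal (x powr p) \<le> fock_norm_pow \<alpha> p f" "x \<ge> 0" "p > 0"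
  shows "ennreal x \<le> fock_norm \<alpha> p f"
proof (cases "fock_norm_pow \<alpha> p f")
  case (real r)
  then have "x powr p \<le> r"
    using assms by (simp add: ennreal_le_iff)
  then have "(x powr p) powr (1 / p) \<le> r powr (1 / p)"
    using assms by (intro powr_mono2) auto
  then show ?thesis
    using assms real by (simp add: fock_norm_def powr_powr ennreal_leI)
qed (simp add: fock_norm_def)

lemma fock_norm_eqI:
  assumes "fock_norm_pow \<alpha> p f = ennreal (x powr p)" "x \<ge> 0" "p > 0"
  shows "fock_norm \<alpha> p f = ennreal x"
  using assms by (simp add: fock_norm_def powr_powr)

section \<open>The estimate, its extremal functions and sharpness\<close>

lemma fock_taylor_estimate:
  assumes \<alpha>: "\<alpha> > 0" and p: "1 \<le> p" and n: "n \<ge> 1" and hol: "f holomorphic_on UNIV"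
  shows "ennreal (cmod ((deriv ^^ n) f z))
    \<le> ennreal (fock_const \<alpha> p n (cmod z)) * fock_norm \<alpha> p (\<lambda>w. f w - taylor_poly n f z w)"
proof -
  define M where "M = fock_moment \<alpha> p n"
  have M: "M > 0"
    using fock_moment_pos[of \<alpha> p n] \<alpha> p by (simp add: M_def)
  obtain h where h: "h holomorphic_on UNIV"
    and rem: "\<And>w. f w - taylor_poly n f z w = (w - z) ^ n * h w"
    and hz: "h z = (deriv ^^ n) f z / fact n"
    using entire_taylor_remainder[OF hol] by metis
  \<comment> \<open>With \<open>w = z + u\<close> and the twist of the translation formula, the
    remainder \<open>(w - z) ^ n * h w\<close> becomes \<open>u ^ n * H u\<close>.\<close>
  define H where "H = (\<lambda>u::complex. h (z + u) * exp (- (\<alpha> * u * cnj z) - \<alpha> * (cmod z)\<^sup>2 / 2))"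
  define \<phi> where "\<phi> = (\<lambda>r. ennreal ((r ^ n) powr p * exp (- (p * \<alpha> * r\<^sup>2 / 2))))"
  have [measurable]: "\<phi> \<in> borel_measurable borel"
    unfolding \<phi>_def by measurable
  have [measurable]: "h \<in> borel_measurable borel"
    by (intro borel_measurable_continuous_onI holomorphic_on_imp_continuous_on h)
  have H: "H holomorphic_on UNIV"
    unfolding H_def
    by (intro holomorphic_intros holomorphic_on_compose_gen[OF _ h, unfolded o_def]) auto
  then have [measurable]: "H \<in> borel_measurable borel"
    by (intro borel_measurable_continuous_onI holomorphic_on_imp_continuous_on)
  \<comment> \<open>\<open>x\<close> is the Fock norm of \<open>H 0 * u ^ n\<close>, the value
    obtained when \<open>H\<close> is replaced by its value at the centre.\<close>
  define x where "x = cmod (H 0) * M powr (1 / p)"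
  have "ennreal (x powr p) = ennreal (cmod (H 0) powr p) * fock_norm_pow \<alpha> p (\<lambda>u. u ^ n)"
    using \<alpha> p n M by (simp add: fock_norm_pow_monomial x_def powr_mult powr_powr M_def ennreal_mult)
  also have "\<dots> = ennreal (p * \<alpha> / (2 * pi))
      * (ennreal (cmod (H 0) powr p) * (\<integral>\<^sup>+(u::complex). \<phi> (cmod u) \<partial>lborel))"
    by (simp add: fock_norm_pow_def nn_integral_completion \<phi>_def norm_power mult_ac)
  also have "\<dots> \<le> ennreal (p * \<alpha> / (2 * pi)) * (\<integral>\<^sup>+u. ennreal (cmod (H u) powr p) * \<phi> (cmod u) \<partial>lborel)"
    by (intro mult_left_mono entire_radial_integral_ge H p) auto
  also have "\<dots> = fock_norm_pow \<alpha> p (\<lambda>u. u ^ n * H u)"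
    by (simp add: fock_norm_pow_def nn_integral_completion \<phi>_def norm_mult norm_power powr_mult
        ennreal_mult[symmetric] mult_ac)
  also have "\<dots> = fock_norm_pow \<alpha> p (\<lambda>w. f w - taylor_poly n f z w)"
    unfolding rem by (subst fock_norm_pow_translate[of _ _ _ z]) (simp_all add: H_def mult_ac)
  finally have "ennreal x \<le> fock_norm \<alpha> p (\<lambda>w. f w - taylor_poly n f z w)"
    using p by (intro fock_norm_ge) (auto simp: x_def)
  then have "ennreal (fock_const \<alpha> p n (cmod z)) * ennreal x
      \<le> ennreal (fock_const \<alpha> p n (cmod z)) * fock_norm \<alpha> p (\<lambda>w. f w - taylor_poly n f z w)"
    by (rule mult_left_mono) simp
  \<comment> \<open>\<open>H 0\<close> carries the twist \<open>exp (- \<alpha> |z|^2 / 2)\<close>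
    and the denominator \<open>fact n\<close> of the Taylor coefficient; the constant undoes both
    and divides out the norm of \<open>u ^ n\<close>.\<close>
  moreover have "fock_const \<alpha> p n (cmod z) * x = cmod ((deriv ^^ n) f z)"
    using M \<alpha> p by (simp add: fock_const_eq x_def H_def hz norm_mult norm_divide exp_minus
        field_simps flip: M_def)
  ultimately show ?thesis
    using M \<alpha> p by (simp add: fock_const_eq x_def flip: ennreal_mult M_def)
qed

text \<open>The exponential in \<open>f\<close> is chosen to cancel the twist of the translation
  formula: moved to 0, \<open>f\<close> is a constant times \<open>u ^ n\<close>. It has a zero of
  order \<open>n\<close> at \<open>z\<close>, so its Taylor polynomial there vanishes and the
  remainder is \<open>f\<close> itself.\<close>

lemma fock_extremal:
  fixes \<alpha> p :: real and n :: nat and z :: complex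
  assumes \<alpha>: "\<alpha> > 0" and p: "1 \<le> p" and n: "n \<ge> 1"
  defines "f \<equiv> \<lambda>w. exp (\<alpha> * (w - z) * cnj z) * (w - z) ^ n"
  shows "f \<in> fock_space \<alpha> p"
    and "fock_norm \<alpha> p (\<lambda>w. f w - taylor_poly n f z w) = ennreal (fact n / fock_const \<alpha> p n (cmod z))"
    and "(deriv ^^ n) f z = fact n"
proof -
  define M where "M = fock_moment \<alpha> p n"
  have M: "M > 0"
    using fock_moment_pos[of \<alpha> p n] \<alpha> p by (simp add: M_def)
  have hol: "f holomorphic_on UNIV"
    unfolding f_def by (intro holomorphic_intros)
  have derivs: "(deriv ^^ k) f z = (if k = n then fact n else 0)" if "k \<le> n" for k
    unfolding f_def using that by (subst higher_deriv_power_mult) (auto intro!: holomorphic_intros)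
  then show "(deriv ^^ n) f z = fact n"
    by simp
  have taylor: "taylor_poly n f z w = 0" for w
    by (simp add: taylor_poly_def derivs)
  \<comment> \<open>\<open>E\<close> is what remains of the twist after the parts depending on
    \<open>u\<close> cancel.\<close>
  define E where "E = exp (- (\<alpha> * (cmod z)\<^sup>2 / 2))"
  have "f (z + u) * exp (- (\<alpha> * u * cnj z) - \<alpha> * (cmod z)\<^sup>2 / 2) = of_real E * u ^ n" for u :: complex
  proof -
    have "exp (\<alpha> * u * cnj z) * exp (- (\<alpha> * u * cnj z) - \<alpha> * (cmod z)\<^sup>2 / 2) = of_real E"
      by (simp add: E_def mult_exp_exp flip: exp_of_real)
    then show ?thesis
      by (simp add: f_def mult_ac)
  qed
  then have "fock_norm_pow \<alpha> p f = fock_norm_pow \<alpha> p (\<lambda>u. of_real E * u ^ n)"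
    by (subst fock_norm_pow_translate[of _ _ _ z])
      (auto intro!: borel_measurable_continuous_onI holomorphic_on_imp_continuous_on hol)
  also have "\<dots> = ennreal (E powr p) * fock_norm_pow \<alpha> p (\<lambda>u. u ^ n)"
    by (subst fock_norm_pow_cmult) (simp_all add: E_def)
  also have "\<dots> = ennreal ((E * M powr (1 / p)) powr p)"
    using \<alpha> p n M by (simp add: fock_norm_pow_monomial powr_mult powr_powr ennreal_mult E_def flip: M_def)
  finally have "fock_norm \<alpha> p f = ennreal (E * M powr (1 / p))"
    using p by (intro fock_norm_eqI) (auto simp: E_def)
  also have "E * M powr (1 / p) = fact n / fock_const \<alpha> p n (cmod z)"
    using \<alpha> p by (simp add: fock_const_eq E_def exp_minus field_simps flip: M_def)
  finally have norm: "fock_norm \<alpha> p f = ennreal (fact n / fock_const \<alpha> p n (cmod z))" .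
  then show "fock_norm \<alpha> p (\<lambda>w. f w - taylor_poly n f z w) = ennreal (fact n / fock_const \<alpha> p n (cmod z))"
    by (simp add: taylor)
  show "f \<in> fock_space \<alpha> p"
    using hol norm by (simp add: fock_space_def)
qed

lemma fock_const_pos:
  assumes "\<alpha> > 0" "p > 0"
  shows "fock_const \<alpha> p n r > 0"
  using fock_moment_pos[of \<alpha> p n] assms by (simp add: fock_const_eq)

lemma fock_taylor_sharp:
  assumes \<alpha>: "\<alpha> > 0" and p: "1 \<le> p" and n: "n \<ge> 1"
  shows "\<forall>f \<in> fock_space \<alpha> p. ennreal (cmod ((deriv ^^ n) f z))
      \<le> ennreal (fock_const \<alpha> p n (cmod z)) * fock_norm \<alpha> p (\<lambda>w. f w - taylor_poly n f z w)"
    and "\<forall>C\<ge>0. (\<forall>f \<in> fock_space \<alpha> p. ennreal (cmod ((deriv ^^ n) f z))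
        \<le> ennreal C * fock_norm \<alpha> p (\<lambda>w. f w - taylor_poly n f z w)) \<longrightarrow>
      fock_const \<alpha> p n (cmod z) \<le> C"
    and "let f = (\<lambda>w. exp (\<alpha> * (w - z) * cnj z) * (w - z) ^ n) in
      f \<in> fock_space \<alpha> p \<and> ennreal (cmod ((deriv ^^ n) f z))
        = ennreal (fock_const \<alpha> p n (cmod z)) * fock_norm \<alpha> p (\<lambda>w. f w - taylor_poly n f z w)"
proof -
  define K where "K = fock_const \<alpha> p n (cmod z)"
  have K: "K > 0"
    using fock_const_pos \<alpha> p by (simp add: K_def)
  note extremal = fock_extremal[OF assms, of z, folded K_def]
  show "\<forall>f \<in> fock_space \<alpha> p. ennreal (cmod ((deriv ^^ n) f z))
      \<le> ennreal (fock_const \<alpha> p n (cmod z)) * fock_norm \<alpha> p (\<lambda>w. f w - taylor_poly n f z w)"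
    using fock_taylor_estimate[OF assms] by (auto simp: fock_space_def)
  show "let f = (\<lambda>w. exp (\<alpha> * (w - z) * cnj z) * (w - z) ^ n) in
      f \<in> fock_space \<alpha> p \<and> ennreal (cmod ((deriv ^^ n) f z))
        = ennreal (fock_const \<alpha> p n (cmod z)) * fock_norm \<alpha> p (\<lambda>w. f w - taylor_poly n f z w)"
    using extremal K by (simp add: Let_def flip: K_def ennreal_mult)
  show "\<forall>C\<ge>0. (\<forall>f \<in> fock_space \<alpha> p. ennreal (cmod ((deriv ^^ n) f z))
        \<le> ennreal C * fock_norm \<alpha> p (\<lambda>w. f w - taylor_poly n f z w)) \<longrightarrow>
      fock_const \<alpha> p n (cmod z) \<le> C"
  proof (intro allI impI)
    fix C :: real
    assume C: "C \<ge> 0" and bound: "\<forall>f \<in> fock_space \<alpha> p. ennreal (cmod ((deriv ^^ n) f z))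
        \<le> ennreal C * fock_norm \<alpha> p (\<lambda>w. f w - taylor_poly n f z w)"
    \<comment> \<open>The extremal function turns the assumed bound into an inequality between
      finite numbers, \<open>fact n \<le> C * (fact n / K)\<close>, that is
      \<open>K \<le> C\<close>.\<close>
    have "ennreal (fact n) \<le> ennreal (C * (fact n / K))"
      using bound[rule_format, OF extremal(1)] C K
      by (simp add: extremal(2,3) norm_fact flip: ennreal_mult)
    then show "fock_const \<alpha> p n (cmod z) \<le> C"
      using C K by (simp add: ennreal_le_iff field_simps flip: K_def)
  qed
qed

text \<open>These identities turn the case \<open>n = 1\<close> of the general result into its
  explicit form for the first derivative.\<close>

lemma first_order:
  "taylor_poly (Suc 0) f z w = f z"
  "fock_const \<alpha> p (Suc 0) r = (\<alpha> * p / 2) powr (1 / 2) / Gamma (1 + p / 2) powr (1 / p) * exp (\<alpha> * r\<^sup>2 / 2)"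
  by (simp_all add: taylor_poly_def fock_const_def)

theorem theorem2p1:
  fixes \<alpha> p :: real
  assumes "\<alpha> > 0" and "1 \<le> p"
  shows
    "(\<forall>n::nat. n \<ge> 1 \<longrightarrow> (\<forall>z::complex.
        (\<forall>f \<in> fock_space \<alpha> p.
           ennreal (cmod ((deriv ^^ n) f z))
             \<le> ennreal (fock_const \<alpha> p n (cmod z)) * fock_norm \<alpha> p (\<lambda>w. f w - taylor_poly n f z w)) \<and>
        (\<forall>C::real. C \<ge> 0 \<longrightarrow>
           (\<forall>f \<in> fock_space \<alpha> p.
              ennreal (cmod ((deriv ^^ n) f z))
                \<le> ennreal C * fock_norm \<alpha> p (\<lambda>w. f w - taylor_poly n f z w)) \<longrightarrow>
           fock_const \<alpha> p n (cmod z) \<le> C) \<and>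
        (let f = (\<lambda>w. exp (\<alpha> * (w - z) * cnj z) * (w - z) ^ n) in
           f \<in> fock_space \<alpha> p \<and>
           ennreal (cmod ((deriv ^^ n) f z))
             = ennreal (fock_const \<alpha> p n (cmod z)) * fock_norm \<alpha> p (\<lambda>w. f w - taylor_poly n f z w))))
     \<and>
     (\<forall>z::complex.
        (\<forall>f \<in> fock_space \<alpha> p.
           ennreal (cmod (deriv f z))
             \<le> ennreal ((\<alpha> * p / 2) powr (1 / 2) / Gamma (1 + p / 2) powr (1 / p) * exp (\<alpha> * (cmod z)\<^sup>2 / 2))
                 * fock_norm \<alpha> p (\<lambda>w. f w - f z)) \<and>
        (\<forall>C::real. C \<ge> 0 \<longrightarrow>
           (\<forall>f \<in> fock_space \<alpha> p.
              ennreal (cmod (deriv f z)) \<le> ennreal C * fock_norm \<alpha> p (\<lambda>w. f w - f z)) \<longrightarrow>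
           (\<alpha> * p / 2) powr (1 / 2) / Gamma (1 + p / 2) powr (1 / p) * exp (\<alpha> * (cmod z)\<^sup>2 / 2) \<le> C) \<and>
        (let f = (\<lambda>w. exp (\<alpha> * (w - z) * cnj z) * (w - z)) in
           f \<in> fock_space \<alpha> p \<and>
           ennreal (cmod (deriv f z))
             = ennreal ((\<alpha> * p / 2) powr (1 / 2) / Gamma (1 + p / 2) powr (1 / p) * exp (\<alpha> * (cmod z)\<^sup>2 / 2))
                 * fock_norm \<alpha> p (\<lambda>w. f w - f z)))"
proof (intro conjI allI impI, goal_cases)
  case (1 n z)
  then show ?case using fock_taylor_sharp(1)[OF assms] by blast
next
  case (2 n z C)
  then show ?case using fock_taylor_sharp(2)[OF assms] by blast
next
  case (3 n z)
  then show ?case using fock_taylor_sharp(3)[OF assms] by blast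
next
  case (4 z)
  then show ?case using fock_taylor_sharp(1)[OF assms order_refl, of z] by (simp add: first_order)
next
  case (5 z C)
  then show ?case using fock_taylor_sharp(2)[OF assms order_refl, of z] by (simp add: first_order)
next
  case (6 z)
  then show ?case using fock_taylor_sharp(3)[OF assms order_refl, of z] by (simp add: first_order)
qed

end
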